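(* Let $A\subset\mathbb{N}_{+}$ be non-empty. For all $k,n\in\mathbb{N}$ the following identities hold: $$S_{A,k+1}(n)=\sum_{i=0}^{n}i\,q_{A}(n-i)\,S_{A,k}(i)$$ and $$S_{A,k+1}(n)=\sum_{i=0}^{n-1}\sum_{j=0}^{k}\binom{k}{j}S_{A,j}(n-i)\,S_{A,k-j}(i).$$ In particular, if $(-1)^{n}S_{A,0}(n)\geq 0$ for all $n\in\mathbb{N}$, then for each $k\in\mathbb{N}$ we have $(-1)^{n}S_{A,k}(n)\geq 0$ for all $n\in\mathbb{N}$.
   Context: $\mathbb{N}$ is the set of non-negative integers and $\mathbb{N}_{+}$ the set of positive integers. For $A\subset\mathbb{N}_{+}$ and $i,n\in\mathbb{N}$, $c_{A}(i,n)$ denotes the number of $A$-compositions of $n$ with exactly $i$ parts, i.e. the number of (ordered) sequences $(\lambda_{1},\ldots,\lambda_{i})$ with all $\lambda_{j}\in A$ and $\lambda_{1}+\cdots+\lambda_{i}=n$ (so $c_A(0,0)=1$ and $c_A(0,n)=0$ for $n\ge 1$). For $k,n\in\mathbb{N}$ put $$S_{A,k}(n)=\sum_{i=0}^{n}(-1)^{i}i^{k}c_{A}(i,n),$$ with the convention $0^{0}=1$. Let $f_{A}(x)=\sum_{a\in A}x^{a}$ (formal power series), with formal derivative $f_A'(x)$. For non-empty $A$, the numbers $q_{A}(n)$ are defined by the power series expansion $$\frac{f_{A}(x)}{x f_{A}'(x)}=\sum_{n=0}^{\infty}q_{A}(n)x^{n}.$$ Empty sums are $0$. *)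

theory Defs
  imports "HOL-Computational_Algebra.Formal_Power_Series"
begin

definition compositions :: "nat set \<Rightarrow> nat \<Rightarrow> nat \<Rightarrow> nat list set" where
  "compositions A i n = {xs. length xs = i \<and> set xs \<subseteq> A \<and> sum_list xs = n}"

definition num_compositions :: "nat set \<Rightarrow> nat \<Rightarrow> nat \<Rightarrow> nat" where
  "num_compositions A i n = card (compositions A i n)"

definition S_comp :: "nat set \<Rightarrow> nat \<Rightarrow> nat \<Rightarrow> int" where
  "S_comp A k n = (\<Sum>i=0..n. (-1) ^ i * int i ^ k * int (num_compositions A i n))"

definition f_gf :: "nat set \<Rightarrow> rat fps" where
  "f_gf A = Abs_fps (\<lambda>n. if n \<in> A then 1 else 0)"

(* Division of formal power series over a field is the true quotient only if it is exact.
   Here it is: if m is the least element of A, with m > 0, then f_gf A and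
   fps_X * fps_deriv (f_gf A) both have subdegree m; see f_gf_eq_q_coeff_mult below. *)
definition q_coeff :: "nat set \<Rightarrow> nat \<Rightarrow> rat" where
  "q_coeff A n = fps_nth (f_gf A / (fps_X * fps_deriv (f_gf A))) n"

lemma f_gf_eq_q_coeff_mult:
  assumes "A \<subseteq> {0<..}" and "A \<noteq> {}"
  shows "fps_X * fps_deriv (f_gf A) \<noteq> 0"
    and "Abs_fps (q_coeff A) * (fps_X * fps_deriv (f_gf A)) = f_gf A"
proof -
  let ?g = "fps_X * fps_deriv (f_gf A)"
  have nth: "fps_nth ?g n = of_nat n * fps_nth (f_gf A) n" for n
    by (cases n) (simp_all add: fps_X_mult_nth)
  obtain a where a: "a \<in> A" using assms by blast
  have "fps_nth ?g a \<noteq> 0" using a assms by (auto simp: nth f_gf_def)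
  then show g: "?g \<noteq> 0" by (metis fps_zero_nth)
  have nz: "f_gf A \<noteq> 0" using a by (auto simp: f_gf_def fps_eq_iff)
  have "subdegree ?g \<le> subdegree (f_gf A)"
  proof (rule subdegree_leI)
    have "fps_nth (f_gf A) (subdegree (f_gf A)) \<noteq> 0"
      using nz by (rule nth_subdegree_nonzero)
    moreover from this have "subdegree (f_gf A) \<noteq> 0"
      using assms by (auto simp: f_gf_def split: if_splits)
    ultimately show "fps_nth ?g (subdegree (f_gf A)) \<noteq> 0" by (simp add: nth)
  qed
  then have "?g dvd f_gf A" using g nz fps_dvd_iff by blast
  moreover have "Abs_fps (q_coeff A) = f_gf A / ?g" by (simp add: q_coeff_def fps_eq_iff)
  ultimately show "Abs_fps (q_coeff A) * ?g = f_gf A" by simp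
qed

end

theory Submission
  imports Defs
begin

text \<open>
  The number of \<open>A\<close>-compositions of \<open>n\<close> with \<open>i\<close> parts is the coefficient of \<open>x^n\<close> in \<open>f^i\<close>, where
  \<open>f\<close> is the generating function of \<open>A\<close>. So \<open>S_comp A k\<close> is the coefficient sequence of
  \<open>F\<^sub>k = (\<Sum>i. (-1)^i * i^k * f^i)\<close>, and both identities compare series of this shape.

  The Euler operator \<open>x d/dx\<close> sends \<open>f^i\<close> to \<open>i * f^(i-1) * (x f')\<close>; hence
  \<open>f * (x F\<^sub>k') = (x f') * F\<^sub>k\<^sub>+\<^sub>1\<close>, and cancelling \<open>x f'\<close> turns this into the identity with \<open>q_coeff\<close>
  (lemma \<open>weighted_geometric_Suc\<close>).

  The binomial theorem gives
  \<open>(\<Sum>j\<le>k. (k choose j) * F\<^sub>j * F\<^sub>k\<^sub>-\<^sub>j) = (\<Sum>a b. (-1)^(a+b) * (a+b)^k * f^(a+b))\<close>. Each \<open>m = a + b\<close>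
  arises from \<open>m + 1\<close> pairs, so the right-hand side is \<open>F\<^sub>k\<^sub>+\<^sub>1 + F\<^sub>k\<close> (lemma
  \<open>binomial_convolution_S_comp\<close>). The part of the convolution that involves the constant
  coefficients of the first factor is exactly \<open>F\<^sub>k\<close>, because the constant coefficient of \<open>F\<^sub>j\<close> is
  \<open>0^j\<close>; dropping it leaves \<open>F\<^sub>k\<^sub>+\<^sub>1\<close>.

  The second identity expresses \<open>(-1)^n * S_comp A (k + 1) n\<close> as a sum with nonnegative weights of
  products \<open>((-1)^(n-i) * S_comp A j (n - i)) * ((-1)^i * S_comp A (k - j) i)\<close> with \<open>j \<le> k\<close>, so the
  sign pattern is inherited from \<open>k = 0\<close> by strong induction.
\<close>

lemma finite_compositions: "finite (compositions A i n)"
proof (rule finite_subset)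
  show "compositions A i n \<subseteq> {xs. set xs \<subseteq> {..n} \<and> length xs = i}"
    by (auto simp: compositions_def member_le_sum_list)
  show "finite {xs. set xs \<subseteq> {..n} \<and> length xs = i}"
    by (rule finite_lists_length_eq) simp
qed

lemma compositions_Suc:
  "compositions A (Suc i) n = (\<Union>a\<in>A \<inter> {..n}. Cons a ` compositions A i (n - a))"
proof (intro equalityI subsetI)
  fix xs assume "xs \<in> compositions A (Suc i) n"
  then show "xs \<in> (\<Union>a\<in>A \<inter> {..n}. Cons a ` compositions A i (n - a))"
    by (cases xs) (force simp: compositions_def)+
qed (auto simp: compositions_def)

lemma num_compositions_Suc:
  "num_compositions A (Suc i) n = (\<Sum>a\<in>A \<inter> {..n}. num_compositions A i (n - a))"
  unfolding num_compositions_def compositions_Suc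
  by (subst card_UN_disjoint) (auto simp: finite_compositions card_image)

lemma f_gf_power_nth: "fps_nth (f_gf A ^ i) n = of_nat (num_compositions A i n)"
proof (induction i arbitrary: n)
  case 0
  have "compositions A 0 n = (if n = 0 then {[]} else {})"
    by (auto simp: compositions_def)
  then show ?case
    by (simp add: num_compositions_def)
next
  case (Suc i)
  have "fps_nth (f_gf A ^ Suc i) n
      = (\<Sum>a\<in>{..n}. if a \<in> A then of_nat (num_compositions A i (n - a)) else 0)"
    unfolding power_Suc fps_mult_nth Suc.IH atLeast0AtMost
    by (intro sum.cong refl) (simp add: f_gf_def)
  also have "\<dots> = of_nat (num_compositions A (Suc i) n)"
    by (simp add: num_compositions_Suc sum.If_cases Int_commute)
  finally show ?case .
qed

text \<open>
  A composition has at most as many parts as its size, so coefficients up to \<open>N\<close> of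
  \<open>(\<Sum>i. (-1)^i * i^k * f^i)\<close> only depend on the powers up to \<open>N\<close>. Working with the partial sums
  avoids infinite sums of power series, and the differential equation relating the exponents \<open>k\<close>
  and \<open>k + 1\<close> holds for them exactly.
\<close>
definition weighted_geometric :: "rat fps \<Rightarrow> nat \<Rightarrow> nat \<Rightarrow> rat fps" where
  "weighted_geometric f k N = (\<Sum>i\<le>N. fps_const ((-1) ^ i * of_nat i ^ k) * f ^ i)"

lemma f_gf_power_nth_eq_0:
  assumes "A \<subseteq> {0<..}" and "n < i"
  shows "fps_nth (f_gf A ^ i) n = 0"
proof -
  have "fps_nth (f_gf A) 0 = 0"
    using assms by (auto simp: f_gf_def)
  then show ?thesis
    using startsby_zero_power_prefix assms by blast
qed

lemma weighted_geometric_nth: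
  assumes "A \<subseteq> {0<..}" and "n \<le> N"
  shows "fps_nth (weighted_geometric (f_gf A) k N) n = of_int (S_comp A k n)"
proof -
  have "fps_nth (weighted_geometric (f_gf A) k N) n
      = (\<Sum>i\<le>N. (-1) ^ i * of_nat i ^ k * fps_nth (f_gf A ^ i) n)"
    by (simp add: weighted_geometric_def fps_sum_nth)
  also have "\<dots> = (\<Sum>i\<le>n. (-1) ^ i * of_nat i ^ k * fps_nth (f_gf A ^ i) n)"
    using assms by (intro sum.mono_neutral_right) (auto simp: f_gf_power_nth_eq_0)
  also have "\<dots> = of_int (S_comp A k n)"
    by (simp add: S_comp_def f_gf_power_nth atLeast0AtMost)
  finally show ?thesis .
qed

text \<open>Termwise this is \<open>f * (f^i)' = i * f^i * f'\<close>; the factor \<open>i\<close> raises the exponent \<open>k\<close>.\<close>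
lemma weighted_geometric_deriv:
  "f * fps_deriv (weighted_geometric f k N) = weighted_geometric f (Suc k) N * fps_deriv f"
proof -
  have deriv: "f * fps_deriv (f ^ i) = of_nat i * f ^ i * fps_deriv f" for i
    by (induction i) (simp_all add: algebra_simps)
  have "f * fps_deriv (weighted_geometric f k N)
      = (\<Sum>i\<le>N. fps_const ((-1) ^ i * of_nat i ^ k) * (f * fps_deriv (f ^ i)))"
    by (simp add: weighted_geometric_def fps_deriv_sum sum_distrib_left mult.left_commute)
  also have "\<dots> = (\<Sum>i\<le>N. fps_const ((-1) ^ i * of_nat i ^ Suc k) * f ^ i * fps_deriv f)"
  proof (rule sum.cong)
    fix i
    have "fps_const ((-1) ^ i * of_nat i ^ Suc k :: rat)
        = fps_const ((-1) ^ i * of_nat i ^ k) * of_nat i"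
      by (simp add: fps_of_nat[symmetric] mult_ac)
    then show "fps_const ((-1) ^ i * of_nat i ^ k) * (f * fps_deriv (f ^ i))
        = fps_const ((-1) ^ i * of_nat i ^ Suc k) * f ^ i * fps_deriv f"
      by (simp only: deriv mult.assoc)
  qed simp
  also have "\<dots> = weighted_geometric f (Suc k) N * fps_deriv f"
    by (simp add: weighted_geometric_def sum_distrib_right)
  finally show ?thesis .
qed

lemma weighted_geometric_Suc:
  assumes "A \<subseteq> {0<..}" and "A \<noteq> {}"
  shows "weighted_geometric (f_gf A) (Suc k) N
    = Abs_fps (q_coeff A) * (fps_X * fps_deriv (weighted_geometric (f_gf A) k N))"
proof -
  let ?g = "fps_X * fps_deriv (f_gf A)" and ?F = "\<lambda>k. weighted_geometric (f_gf A) k N"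
  have "?g * ?F (Suc k) = fps_X * (f_gf A * fps_deriv (?F k))"
    unfolding weighted_geometric_deriv by (simp only: mult_ac)
  also have "\<dots> = fps_X * ((Abs_fps (q_coeff A) * ?g) * fps_deriv (?F k))"
    by (simp only: f_gf_eq_q_coeff_mult(2)[OF assms])
  also have "\<dots> = ?g * (Abs_fps (q_coeff A) * (fps_X * fps_deriv (?F k)))"
    by (simp only: mult_ac)
  finally show ?thesis
    using f_gf_eq_q_coeff_mult(1)[OF assms] by (simp only: mult_cancel_left) blast
qed

lemma S_comp_Suc_q_coeff:
  assumes "A \<subseteq> {0<..}" and "A \<noteq> {}"
  shows "of_int (S_comp A (Suc k) n)
    = (\<Sum>i=0..n. of_nat i * q_coeff A (n - i) * of_int (S_comp A k i))"
proof -
  let ?F = "\<lambda>k. weighted_geometric (f_gf A) k n"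
  have euler: "fps_nth (fps_X * fps_deriv (?F k)) i = of_nat i * of_int (S_comp A k i)"
    if "i \<le> n" for i
    using that by (cases i) (simp_all add: fps_X_mult_nth weighted_geometric_nth[OF assms(1)])
  have "of_int (S_comp A (Suc k) n) = fps_nth (?F (Suc k)) n"
    by (simp add: weighted_geometric_nth[OF assms(1)])
  also have "\<dots> = fps_nth ((fps_X * fps_deriv (?F k)) * Abs_fps (q_coeff A)) n"
    by (simp only: weighted_geometric_Suc[OF assms] mult.commute)
  also have "\<dots> = (\<Sum>i=0..n. of_nat i * q_coeff A (n - i) * of_int (S_comp A k i))"
    by (subst fps_mult_nth, intro sum.cong) (simp_all add: euler del: fps_X_mult_nth)
  finally show ?thesis .
qed

text \<open>
  The vanishing of \<open>g\<close> beyond \<open>n\<close> reduces the square to the triangle \<open>a + b \<le> n\<close>, whose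
  antidiagonal \<open>a + b = m\<close> has \<open>m + 1\<close> points.
\<close>
lemma sum_square_by_antidiagonals:
  fixes g :: "nat \<Rightarrow> 'a::comm_semiring_1"
  assumes "\<And>m. n < m \<Longrightarrow> g m = 0"
  shows "(\<Sum>a\<le>n. \<Sum>b\<le>n. g (a + b)) = (\<Sum>m\<le>n. of_nat (m + 1) * g m)"
proof -
  have "(\<Sum>a\<le>n. \<Sum>b\<le>n. g (a + b)) = (\<Sum>(a, b)\<in>{..n} \<times> {..n}. g (a + b))"
    by (simp add: sum.cartesian_product)
  also have "\<dots> = (\<Sum>(a, b)\<in>{(a, b). a + b \<le> n}. g (a + b))"
    by (intro sum.mono_neutral_right) (auto simp: assms simp flip: not_less)
  also have "\<dots> = (\<Sum>m\<le>n. of_nat (m + 1) * g m)"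
    by (simp add: sum.triangle_reindex_eq)
  finally show ?thesis .
qed

lemma binomial_convolution_S_comp:
  assumes "A \<subseteq> {0<..}"
  shows "(\<Sum>i=0..n. \<Sum>j=0..k. int (k choose j) * S_comp A j (n - i) * S_comp A (k - j) i)
    = S_comp A (Suc k) n + S_comp A k n"
proof -
  define f where "f = f_gf A"
  let ?F = "\<lambda>k. weighted_geometric f k n"
  let ?c = "\<lambda>m. fps_nth (f ^ m) n"
  have nth: "of_int (S_comp A j i) = fps_nth (?F j) i" if "i \<le> n" for i j
    using weighted_geometric_nth[OF assms that] by (simp add: f_def)
  have coeff: "fps_nth (?F j) n = (\<Sum>m\<le>n. (-1) ^ m * of_nat m ^ j * ?c m)" for j
    by (simp add: weighted_geometric_def fps_sum_nth)
  have product: "fps_nth (?F j * ?F l) n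
      = (\<Sum>a\<le>n. \<Sum>b\<le>n. (-1) ^ (a + b) * (of_nat a ^ j * of_nat b ^ l) * ?c (a + b))" for j l
  proof -
    have "?F j * ?F l = (\<Sum>a\<le>n. \<Sum>b\<le>n.
        fps_const ((-1) ^ (a + b) * (of_nat a ^ j * of_nat b ^ l)) * f ^ (a + b))"
      unfolding weighted_geometric_def sum_product
      by (simp add: power_add fps_const_mult[symmetric] mult_ac del: fps_const_mult)
    then show ?thesis
      by (simp add: fps_sum_nth)
  qed
  have "of_int (\<Sum>i=0..n. \<Sum>j=0..k. int (k choose j) * S_comp A j (n - i) * S_comp A (k - j) i)
      = (\<Sum>j\<le>k. of_nat (k choose j) * fps_nth (?F (k - j) * ?F j) n)"
    unfolding fps_mult_nth by (subst sum.swap) (simp add: nth sum_distrib_left mult_ac atLeast0AtMost)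
  also have "\<dots> = (\<Sum>j\<le>k. \<Sum>a\<le>n. \<Sum>b\<le>n. (-1) ^ (a + b) * ?c (a + b)
      * (of_nat (k choose j) * of_nat b ^ j * of_nat a ^ (k - j)))"
    unfolding product by (simp add: sum_distrib_left mult_ac)
  also have "\<dots> = (\<Sum>a\<le>n. \<Sum>j\<le>k. \<Sum>b\<le>n. (-1) ^ (a + b) * ?c (a + b)
      * (of_nat (k choose j) * of_nat b ^ j * of_nat a ^ (k - j)))"
    by (rule sum.swap)
  also have "\<dots> = (\<Sum>a\<le>n. \<Sum>b\<le>n. \<Sum>j\<le>k. (-1) ^ (a + b) * ?c (a + b)
      * (of_nat (k choose j) * of_nat b ^ j * of_nat a ^ (k - j)))"
    by (intro sum.cong refl sum.swap)
  also have "\<dots> = (\<Sum>a\<le>n. \<Sum>b\<le>n. (-1) ^ (a + b) * of_nat (a + b) ^ k * ?c (a + b))"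
  proof (intro sum.cong refl)
    fix a b
    have "of_nat (a + b) ^ k
        = (\<Sum>j\<le>k. of_nat (k choose j) * of_nat b ^ j * of_nat a ^ (k - j) :: rat)"
      by (simp add: binomial_ring[symmetric] add.commute)
    then show "(\<Sum>j\<le>k. (-1) ^ (a + b) * ?c (a + b)
          * (of_nat (k choose j) * of_nat b ^ j * of_nat a ^ (k - j)))
        = (-1) ^ (a + b) * of_nat (a + b) ^ k * ?c (a + b)"
      by (simp add: sum_distrib_left mult_ac)
  qed
  also have "\<dots> = (\<Sum>m\<le>n. of_nat (m + 1) * ((-1) ^ m * of_nat m ^ k * ?c m))"
    by (rule sum_square_by_antidiagonals) (simp add: f_def f_gf_power_nth_eq_0[OF assms])
  also have "\<dots> = fps_nth (?F (Suc k)) n + fps_nth (?F k) n"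
    unfolding coeff by (simp add: sum.distrib[symmetric] algebra_simps)
  also have "\<dots> = of_int (S_comp A (Suc k) n + S_comp A k n)"
    by (simp add: nth)
  finally show ?thesis
    by (simp only: of_int_eq_iff)
qed

lemma S_comp_0_right: "S_comp A k 0 = 0 ^ k"
proof -
  have "compositions A 0 0 = {[]}"
    by (auto simp: compositions_def)
  then show ?thesis
    by (simp add: S_comp_def num_compositions_def)
qed

lemma S_comp_Suc_convolution:
  assumes "A \<subseteq> {0<..}"
  shows "S_comp A (Suc k) n
    = (\<Sum>i\<in>{0..<n}. \<Sum>j=0..k. int (k choose j) * S_comp A j (n - i) * S_comp A (k - j) i)"
proof -
  (* The summand i = n of the full convolution: only j = 0 contributes, as S_comp A j 0 = 0^j. *)
  have "(\<Sum>j=0..k. int (k choose j) * S_comp A j 0 * S_comp A (k - j) n)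
      = (\<Sum>j\<in>{0}. int (k choose j) * S_comp A j 0 * S_comp A (k - j) n)"
    by (intro sum.mono_neutral_right) (auto simp: S_comp_0_right)
  also have "\<dots> = S_comp A k n"
    by (simp add: S_comp_0_right)
  finally show ?thesis
    using binomial_convolution_S_comp[OF assms, where n = n and k = k]
    by (simp add: sum.last_plus[of 0 n] atLeastLessThanSuc_atLeastAtMost[symmetric])
qed

lemma S_comp_alternating:
  assumes "A \<subseteq> {0<..}" and base: "\<And>n. (-1) ^ n * S_comp A 0 n \<ge> 0"
  shows "(-1) ^ n * S_comp A k n \<ge> 0"
proof (induction k arbitrary: n rule: less_induct)
  case (less k)
  show ?case
  proof (cases k)
    case 0
    then show ?thesis
      using base by simp
  next
    case (Suc l)
    have sign: "(-1) ^ n * (int (l choose j) * S_comp A j (n - i) * S_comp A (l - j) i)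
        = int (l choose j) * (((-1) ^ (n - i) * S_comp A j (n - i)) * ((-1) ^ i * S_comp A (l - j) i))"
      if "i < n" for i j
    proof -
      have "(-1 :: int) ^ n = (-1) ^ (n - i) * (-1) ^ i"
        using that by (simp add: power_add[symmetric])
      then show ?thesis
        by (simp add: mult_ac)
    qed
    have "(-1) ^ n * S_comp A k n = (\<Sum>i\<in>{0..<n}. \<Sum>j=0..l. int (l choose j)
        * (((-1) ^ (n - i) * S_comp A j (n - i)) * ((-1) ^ i * S_comp A (l - j) i)))"
      unfolding Suc S_comp_Suc_convolution[OF assms(1)] sum_distrib_left
      by (intro sum.cong refl sign) simp
    also have "\<dots> \<ge> 0"
      using Suc by (intro sum_nonneg mult_nonneg_nonneg less.IH) auto
    finally show ?thesis .
  qed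
qed

theorem corollary2p4:
  fixes A :: "nat set"
  assumes "A \<subseteq> {0<..}" and "A \<noteq> {}"
  shows "(\<forall>k n. of_int (S_comp A (k + 1) n) =
            (\<Sum>i=0..n. of_nat i * q_coeff A (n - i) * of_int (S_comp A k i)))
       \<and> (\<forall>k n. S_comp A (k + 1) n =
            (\<Sum>i\<in>{0..<n}. \<Sum>j=0..k. int (k choose j) * S_comp A j (n - i) * S_comp A (k - j) i))
       \<and> ((\<forall>n. (-1) ^ n * S_comp A 0 n \<ge> 0) \<longrightarrow> (\<forall>k n. (-1) ^ n * S_comp A k n \<ge> 0))"
  using S_comp_Suc_q_coeff[OF assms] S_comp_Suc_convolution[OF assms(1)]
    S_comp_alternating[OF assms(1)] by simp

end
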